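(* Let $k\ge 1$ be an integer and let $\mathbb{F}$ be a field. \begin{enumerate} \item If $|\mathbb{F}| \geq k^2-k+1$ (in particular, if $\mathbb{F}$ is infinite) then $m(k,\mathbb{F}) \leq k^2-k+1$. \item If $\mathbb{F}$ is a finite field of size $q \geq k$ then $m(k,\mathbb{F}) \leq k \cdot \frac{q^{k-1}-1}{q-1}+1$. \end{enumerate}
   Context: Inner product: on $\mathbb{C}^t$, $\langle x,y\rangle=\sum_i x_i\overline{y_i}$; on $\mathbb{F}^t$ for every other field $\mathbb{F}$ (in particular $\mathbb{R}$ and finite fields), $\langle x,y\rangle=\sum_i x_iy_i$. A finite simple graph $G=(V,E)$ is $k$-subspace choosable over $\mathbb{F}$ if for every integer $t$ and every assignment of subspaces $W_v\subseteq\mathbb{F}^t$ with $\dim(W_v)=k$ to the vertices $v\in V$, there exists a choice of a nonzero vector $x_v\in W_v$ for each $v\in V$ such that $\langle x_v,x_{v'}\rangle=0$ whenever $v$ and $v'$ are adjacent in $G$. The subspace choice number $\mathrm{ch\text{-}s}(G,\mathbb{F})$ is the smallest positive integer $k$ for which $G$ is $k$-subspace choosable over $\mathbb{F}$. $K_{k,m}$ is the complete bipartite graph with $k$ vertices on the left side and $m$ on the right side. It always satisfies $\mathrm{ch\text{-}s}(K_{k,m},\mathbb{F})\le k+1$. For an integer $k$ and a field $\mathbb{F}$, $m(k,\mathbb{F})$ denotes the smallest integer $m$ for which $\mathrm{ch\text{-}s}(K_{k,m},\mathbb{F})=k+1$. *)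

theory Defs
  imports
    Complex_Main
    "HOL-Library.Extended_Nat"
    "Jordan_Normal_Form.Conjugate"
    "Jordan_Normal_Form.VS_Connect"
begin

text \<open>A graph is a pair of a vertex set and a set of two-element edges.\<close>

type_synonym 'v graph = "'v set \<times> 'v set set"

definition finite_simple_graph :: "'v graph \<Rightarrow> bool" where
  "finite_simple_graph G \<longleftrightarrow>
     finite (fst G) \<and> snd G \<subseteq> {{u, v} | u v. u \<in> fst G \<and> v \<in> fst G \<and> u \<noteq> v}"

definition complete_bipartite :: "nat \<Rightarrow> nat \<Rightarrow> (nat + nat) graph" where
  "complete_bipartite k m =
     (Inl ` {..<k} \<union> Inr ` {..<m}, {{Inl i, Inr j} | i j. i < k \<and> j < m})"

lemma finite_simple_graph_complete_bipartite:
  "finite_simple_graph (complete_bipartite k m)"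
  unfolding finite_simple_graph_def complete_bipartite_def by fastforce

definition subspace_of_dim :: "nat \<Rightarrow> nat \<Rightarrow> 'a::field vec set \<Rightarrow> bool" where
  "subspace_of_dim t k W \<longleftrightarrow>
     VectorSpace.subspace class_ring W (module_vec TYPE('a) t) \<and>
     vectorspace.dim class_ring ((module_vec TYPE('a) t)\<lparr>carrier := W\<rparr>) = k"

text \<open>
  The inner product is a parameter \<open>ip\<close>, because it depends on the field: it is the
  bilinear product \<open>scalar_prod\<close> in general, but the Hermitian product
  \<open>cscalar_prod\<close>, conjugate-linear in the second argument, over the complex numbers.
\<close>

definition subspace_choosable ::
  "('a::field vec \<Rightarrow> 'a vec \<Rightarrow> 'a) \<Rightarrow> 'v graph \<Rightarrow> nat \<Rightarrow> bool" where
  "subspace_choosable ip G k \<longleftrightarrow>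
     (\<forall>t. \<forall>W :: 'v \<Rightarrow> 'a vec set.
        (\<forall>v \<in> fst G. subspace_of_dim t k (W v)) \<longrightarrow>
        (\<exists>x :: 'v \<Rightarrow> 'a vec.
           (\<forall>v \<in> fst G. x v \<in> W v \<and> x v \<noteq> 0\<^sub>v t) \<and>
           (\<forall>u \<in> fst G. \<forall>v \<in> fst G. {u, v} \<in> snd G \<longrightarrow> ip (x u) (x v) = 0)))"

text \<open>
  Both minima below are infima in \<^typ>\<open>enat\<close>: the infimum of a nonempty set is its least
  element and that of the empty set is \<open>\<infinity>\<close>. Hence a finite upper bound entails that
  the minimum exists.
\<close>

definition subspace_choice_number ::
  "('a::field vec \<Rightarrow> 'a vec \<Rightarrow> 'a) \<Rightarrow> 'v graph \<Rightarrow> enat" where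
  "subspace_choice_number ip G = Inf {enat k | k. k > 0 \<and> subspace_choosable ip G k}"

definition bipartite_threshold :: "('a::field vec \<Rightarrow> 'a vec \<Rightarrow> 'a) \<Rightarrow> nat \<Rightarrow> enat" where
  "bipartite_threshold ip k =
     Inf {enat m | m. subspace_choice_number ip (complete_bipartite k m) = enat (k + 1)}"

end

theory Submission
  imports Defs "Jordan_Normal_Form.DL_Rank"
begin

text \<open>
  For \<open>K\<^bsub>k,m\<^esub>\<close> both halves of the claim that the choice number is \<open>k + 1\<close> are linear algebra.
  Subspaces of dimension \<open>k + 1\<close> always suffice: after arbitrary nonzero vectors are
  chosen on the left, a vertex on the right faces \<open>k\<close> homogeneous linear equations in
  \<open>k + 1\<close> unknowns (\<open>choosable_complete_bipartite_Suc\<close>).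

  Subspaces of dimension \<open>k\<close> can be too small. Split \<open>F\<^sup>k\<^sup>*\<^sup>k\<close> into \<open>k\<close> blocks
  of length \<open>k\<close>. Give the \<open>i\<close>-th left vertex the \<open>i\<close>-th block, so that a choice there
  is a nonzero \<open>x\<^sub>i \<in> F\<^sup>k\<close>. Give the \<open>j\<close>-th right vertex the vectors
  whose \<open>i\<close>-th block is \<open>y\<^sub>i a\<^sub>j\<close>, where \<open>a\<^sub>j \<in> F\<^sup>k\<close> is a fixed nonzero vector and
  \<open>y \<in> F\<^sup>k\<close> is arbitrary. Orthogonality to the left choice says
  \<open>y\<^sub>i \<langle>x\<^sub>i, a\<^sub>j\<rangle> = 0\<close> for all \<open>i\<close>, which forces \<open>y = 0\<close>
  as soon as no \<open>x\<^sub>i\<close> is orthogonal to \<open>a\<^sub>j\<close>. If every hyperplane through the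
  origin contains at most \<open>d\<close> of the vectors \<open>a\<^sub>j\<close>, then the \<open>k\<close> hyperplanes \<open>x\<^sub>i\<^sup>\<bottom>\<close> miss
  one of them once there are more than \<open>k d\<close>; hence
  \<open>m(k, F) \<le> k d + 1\<close> (\<open>threshold_le_if_spread_out\<close>).

  It remains to find \<open>k d + 1\<close> vectors with small \<open>d\<close>. Over a large field, distinct points of
  the moment curve \<open>(1, t, \<dots>, t\<^sup>k\<^sup>-\<^sup>1)\<close> give \<open>d = k - 1\<close>, since a hyperplane
  meets the curve in the roots of a polynomial of degree below \<open>k\<close>
  (\<open>ex_spread_out_vandermonde\<close>). Over a field of size \<open>q\<close>, pairwise non-proportional nonzero vectors
  give \<open>d = (q\<^sup>k\<^sup>-\<^sup>1 - 1) / (q - 1)\<close>, the number of points of a projective hyperplane; the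
  projective space has \<open>q d + 1\<close> points, which is enough for \<open>k \<le> q\<close>
  (\<open>ex_spread_out_projective\<close>).
\<close>

section \<open>Subspaces as images of injective matrices\<close>

definition trivial_kernel :: "'a::field mat \<Rightarrow> bool" where
  "trivial_kernel B \<longleftrightarrow>
     (\<forall>c \<in> carrier_vec (dim_col B). B *\<^sub>v c = 0\<^sub>v (dim_row B) \<longrightarrow> c = 0\<^sub>v (dim_col B))"

lemma nonzero_vec_coordinate:
  assumes "v \<in> carrier_vec k" "v \<noteq> 0\<^sub>v k"
  obtains i where "i < k" "v $ i \<noteq> 0"
  using assms by (metis carrier_vecD eq_vecI index_zero_vec)

lemma trivial_kernel_distinct_cols:
  fixes B :: "'a::field mat"
  assumes "trivial_kernel B"
  shows "distinct (cols B)"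
proof -
  have "col B i \<noteq> col B j" if ij: "i < dim_col B" "j < dim_col B" "i \<noteq> j" for i j
  proof
    assume eq: "col B i = col B j"
    let ?n = "dim_col B"
    have B: "B \<in> carrier_mat (dim_row B) ?n" by simp
    have unit: "B *\<^sub>v unit_vec ?n l = col B l" if "l < ?n" for l
      using that by (intro eq_vecI) (auto simp: scalar_prod_right_unit)
    have "B *\<^sub>v (unit_vec ?n i - unit_vec ?n j) = B *\<^sub>v unit_vec ?n i - B *\<^sub>v unit_vec ?n j"
      by (rule mult_minus_distrib_mat_vec[OF B]) auto
    also have "\<dots> = 0\<^sub>v (dim_row B)"
      using ij eq by (simp add: unit)
    finally have "unit_vec ?n i - unit_vec ?n j = (0\<^sub>v ?n :: 'a vec)"
      using assms unfolding trivial_kernel_def by auto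
    then have "(unit_vec ?n i - unit_vec ?n j) $ i = (0\<^sub>v ?n :: 'a vec) $ i" by simp
    then show False using ij by simp
  qed
  then show ?thesis by (simp add: distinct_conv_nth)
qed

text \<open>
  A dimension is meaningful only in the presence of a finite basis. A subspace has one because
  its independent sets have at most \<open>n\<close> elements, so that a maximal one exists.
\<close>

lemma (in vec_space) subspace_basis_exists:
  assumes W: "VectorSpace.subspace class_ring W V"
  obtains b where "finite b" "b \<subseteq> W" "lin_indpt b" "span b = W"
    "vectorspace.dim class_ring (vs W) = card b"
proof -
  interpret W: vectorspace class_ring "vs W" using subspace_is_vs[OF W] .
  have sub: "submodule class_ring W V" using W unfolding VectorSpace.subspace_def by simp
  have WV: "W \<subseteq> carrier V" using sub unfolding submodule_def by simp
  have li: "W.lin_indpt T = lin_indpt T" if "T \<subseteq> W" for T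
    using span_li_not_depend(2)[OF that sub] by simp
  have bound: "finite T \<and> card T \<le> n" if "T \<subseteq> W" "W.lin_indpt T" for T
    using li_le_dim[OF fin_dim, of T] li that WV dim_is_n by auto
  have li0: "W.lin_indpt {}" unfolding W.lin_dep_def by auto
  obtain b where fb: "finite b" and mb: "maximal b (\<lambda>T. T \<subseteq> W \<and> W.lin_indpt T)"
    using maximal_exists[of "\<lambda>T. T \<subseteq> W \<and> W.lin_indpt T" n "{}"] bound li0 by blast
  then have b: "b \<subseteq> W" "W.lin_indpt b" unfolding maximal_def by auto
  have "W.basis b" 
    using W.max_li_is_basis[of b] mb by (simp add: fb)
  then have "W.span b = W" "W.dim = card b"
    using W.dim_basis[OF fb] by (auto simp: W.basis_def)
  then show thesis using that[of b] b fb li[of b] span_li_not_depend(1)[OF b(1) sub] by simp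
qed

text \<open>
  Parametrizing subspaces by coefficient vectors turns every choice of a nonzero vector
  into a choice of nonzero coordinates, and all later arguments are about matrices.
\<close>

lemma subspace_of_dim_iff_image:
  fixes W :: "'a::field vec set"
  shows "subspace_of_dim t k W \<longleftrightarrow>
    (\<exists>B \<in> carrier_mat t k. trivial_kernel B \<and> W = (\<lambda>c. B *\<^sub>v c) ` carrier_vec k)"
proof -
  interpret vec_space "TYPE('a)" t .
  have image: "span (set (cols B)) = (\<lambda>c. B *\<^sub>v c) ` carrier_vec k"
    if "B \<in> carrier_mat t k" for B
    using col_space_eq[OF that] that unfolding col_space_def by auto
  show ?thesis
  proof
    assume "subspace_of_dim t k W"
    then have W: "VectorSpace.subspace class_ring W V"
      and dim: "vectorspace.dim class_ring (vs W) = k"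
      unfolding subspace_of_dim_def by auto
    obtain b where b: "finite b" "b \<subseteq> W" "lin_indpt b" "span b = W" "card b = k"
      using subspace_basis_exists[OF W] dim by metis
    obtain bs where bs: "set bs = b" "distinct bs"
      using finite_distinct_list[OF b(1)] by auto
    have len: "length bs = k" using bs b(5) distinct_card by fastforce
    define B where "B = mat_of_cols t bs"
    have B: "B \<in> carrier_mat t k" unfolding B_def using len by auto
    have "b \<subseteq> carrier_vec t" using b(2) W
      unfolding VectorSpace.subspace_def submodule_def by auto
    then have cols: "cols B = bs" unfolding B_def using bs by auto
    have "trivial_kernel B"
      unfolding trivial_kernel_def
      using lin_depI[OF B] b(3) B by (auto simp: cols bs)
    then show "\<exists>B \<in> carrier_mat t k. trivial_kernel B \<and> W = (\<lambda>c. B *\<^sub>v c) ` carrier_vec k"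
      using B image[OF B] b(4) by (auto simp: cols bs)
  next
    assume "\<exists>B \<in> carrier_mat t k. trivial_kernel B \<and> W = (\<lambda>c. B *\<^sub>v c) ` carrier_vec k"
    then obtain B where B: "B \<in> carrier_mat t k" and ker: "trivial_kernel B"
      and W: "W = span (set (cols B))" using image by auto
    have dist: "distinct (cols B)" using trivial_kernel_distinct_cols[OF ker] .
    have "lin_indpt (set (cols B))"
      using lin_depE[OF B _ dist] ker B unfolding trivial_kernel_def by auto
    then have "rank B = k" using lin_indpt_full_rank[OF B dist] by simp
    moreover have "set (cols B) \<subseteq> carrier V" using B cols_dim[of B] by auto
    ultimately show "subspace_of_dim t k W"
      unfolding subspace_of_dim_def W rank_def using span_is_subspace by auto
  qed
qed

section \<open>Monotonicity in the dimension\<close>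

lemma subspace_of_dim_subset:
  fixes W :: "'a::field vec set"
  assumes W: "subspace_of_dim t k W" and "j \<le> k"
  obtains U where "subspace_of_dim t j U" "U \<subseteq> W"
proof -
  obtain B where B: "B \<in> carrier_mat t k" and ker: "trivial_kernel B"
    and W: "W = (\<lambda>c. B *\<^sub>v c) ` carrier_vec k"
    using W unfolding subspace_of_dim_iff_image by auto
  \<comment> \<open>The first \<open>j\<close> columns of \<open>B\<close> are \<open>B * E\<close>.\<close>
  define E :: "'a mat" where "E = mat k j (\<lambda>(r, c). if r = c then 1 else 0)"
  have E: "E \<in> carrier_mat k j" unfolding E_def by simp
  have Ec: "(E *\<^sub>v c) $ i = c $ i" if "c \<in> carrier_vec j" "i < j" for c i
    using that assms(2) unfolding E_def
    by (auto simp: scalar_prod_def if_distrib[of "\<lambda>x. x * _"] cong: if_cong)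
  have kerBE: "trivial_kernel (B * E)"
    unfolding trivial_kernel_def
  proof (intro ballI impI)
    fix c assume "c \<in> carrier_vec (dim_col (B * E))"
      and zero: "B * E *\<^sub>v c = 0\<^sub>v (dim_row (B * E))"
    then have c: "c \<in> carrier_vec j" using E by simp
    have "B *\<^sub>v (E *\<^sub>v c) = 0\<^sub>v t"
      using zero assoc_mult_mat_vec[OF B E c] B by simp
    then have "E *\<^sub>v c = 0\<^sub>v k"
      using ker B mult_mat_vec_carrier[OF E c] unfolding trivial_kernel_def by auto
    then have "c = 0\<^sub>v j" using Ec[OF c] c assms(2) by (intro eq_vecI) auto
    then show "c = 0\<^sub>v (dim_col (B * E))" using E by simp
  qed
  have "(\<lambda>c. (B * E) *\<^sub>v c) ` carrier_vec j \<subseteq> W"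
    unfolding W using assoc_mult_mat_vec[OF B E] E by auto
  moreover have "subspace_of_dim t j ((\<lambda>c. (B * E) *\<^sub>v c) ` carrier_vec j)"
    unfolding subspace_of_dim_iff_image using B E kerBE by auto
  ultimately show thesis using that by blast
qed

lemma subspace_choosable_mono:
  assumes ch: "subspace_choosable ip G j" and "j \<le> k"
  shows "subspace_choosable ip G k"
  unfolding subspace_choosable_def
proof (intro allI impI)
  fix t and W :: "'b \<Rightarrow> 'a vec set"
  assume "\<forall>v \<in> fst G. subspace_of_dim t k (W v)"
  then have "\<forall>v \<in> fst G. \<exists>U. subspace_of_dim t j U \<and> U \<subseteq> W v"
    using subspace_of_dim_subset[OF _ \<open>j \<le> k\<close>] by metis
  then obtain U where U: "\<forall>v \<in> fst G. subspace_of_dim t j (U v) \<and> U v \<subseteq> W v"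
    by metis
  then show "\<exists>x. (\<forall>v \<in> fst G. x v \<in> W v \<and> x v \<noteq> 0\<^sub>v t) \<and>
           (\<forall>u \<in> fst G. \<forall>v \<in> fst G. {u, v} \<in> snd G \<longrightarrow> ip (x u) (x v) = 0)"
    using ch[unfolded subspace_choosable_def, rule_format, of t U] by blast
qed


section \<open>Subspaces of dimension k + 1 suffice\<close>

lemma mult_mat_vec_nonzero:
  assumes "trivial_kernel B" "c \<in> carrier_vec (dim_col B)" "c \<noteq> 0\<^sub>v (dim_col B)"
  shows "B *\<^sub>v c \<noteq> 0\<^sub>v (dim_row B)"
  using assms unfolding trivial_kernel_def by auto

lemma homogeneous_system_nonzero_solution:
  fixes A :: "'a::field mat"
  assumes A: "A \<in> carrier_mat k (k + 1)"
  obtains c where "c \<in> carrier_vec (k + 1)" "c \<noteq> 0\<^sub>v (k + 1)" "A *\<^sub>v c = 0\<^sub>v k"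
proof -
  \<comment> \<open>A zero row makes the matrix square and singular.\<close>
  define A' where "A' = mat\<^sub>r (k + 1) (k + 1) (\<lambda>i. if i = k then 0\<^sub>v (k + 1) else row A i)"
  have A': "A' \<in> carrier_mat (k + 1) (k + 1)" unfolding A'_def by simp
  have "det A' = 0"
    using det_row_0[of k "k + 1" "\<lambda>i. row A i"] row_carrier[of A] A
    unfolding A'_def by (simp del: row_carrier)
  then obtain c where c: "c \<in> carrier_vec (k + 1)" "c \<noteq> 0\<^sub>v (k + 1)" "A' *\<^sub>v c = 0\<^sub>v (k + 1)"
    using det_0_iff_vec_prod_zero_field[OF A'] by auto
  have "A *\<^sub>v c = 0\<^sub>v k"
  proof (rule eq_vecI)
    fix i assume "i < dim_vec (0\<^sub>v k :: 'a vec)"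
    then have i: "i < k" by simp
    have "row A' i = row A i"
      unfolding A'_def using i A by (subst row_mat_of_row_fun) auto
    then have "(A *\<^sub>v c) $ i = (A' *\<^sub>v c) $ i" using i A A' by simp
    then show "(A *\<^sub>v c) $ i = 0\<^sub>v k $ i" using c(3) i by simp
  qed (use A in simp)
  then show thesis using that c by blast
qed

text \<open>
  The bilinear product and the Hermitian product over the complex numbers are both of the form
  \<open>x \<bullet> \<sigma>(y)\<close> for an involutive automorphism \<open>\<sigma>\<close> of the field,
  and both are treated at once in this generality.
\<close>

locale conjugation =
  fixes \<sigma> :: "'a::field \<Rightarrow> 'a"
  assumes conj_add: "\<sigma> (x + y) = \<sigma> x + \<sigma> y"
    and conj_mult: "\<sigma> (x * y) = \<sigma> x * \<sigma> y"
    and conj_conj: "\<sigma> (\<sigma> x) = x"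
begin

definition inner :: "'a vec \<Rightarrow> 'a vec \<Rightarrow> 'a" where
  "inner x y = x \<bullet> map_vec \<sigma> y"

lemma conj_zero: "\<sigma> 0 = 0"
  using conj_add[of 0 0] by (simp only: add_0 add_cancel_right_left)

lemma conj_eq_0_iff: "\<sigma> x = 0 \<longleftrightarrow> x = 0"
  by (metis conj_conj conj_zero)

lemma conj_sum: "\<sigma> (\<Sum>i\<in>A. f i) = (\<Sum>i\<in>A. \<sigma> (f i))"
  by (induction A rule: infinite_finite_induct) (auto simp: conj_zero conj_add)

text \<open>
  Edges are unordered, so each edge imposes the orthogonality condition in both orders; only one
  of them has to be dealt with.
\<close>

lemma inner_eq_0_commute:
  assumes "x \<in> carrier_vec t" "y \<in> carrier_vec t"
  shows "inner x y = 0 \<longleftrightarrow> inner y x = 0"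
proof -
  have "inner y x = \<sigma> (inner x y)"
    using assms unfolding inner_def scalar_prod_def
    by (auto simp: conj_sum conj_mult conj_conj mult.commute)
  then show ?thesis by (simp add: conj_eq_0_iff)
qed

lemma choosable_complete_bipartite_Suc:
  "subspace_choosable inner (complete_bipartite k m) (k + 1)"
  unfolding subspace_choosable_def
proof (intro allI impI)
  fix t and W :: "nat + nat \<Rightarrow> 'a vec set"
  let ?G = "complete_bipartite k m"
  assume "\<forall>v \<in> fst ?G. subspace_of_dim t (k + 1) (W v)"
  then have "\<forall>v \<in> fst ?G. \<exists>B \<in> carrier_mat t (k + 1). trivial_kernel B \<and>
      W v = (\<lambda>c. B *\<^sub>v c) ` carrier_vec (k + 1)"
    unfolding subspace_of_dim_iff_image by blast
  then obtain B where B: "\<And>v. v \<in> fst ?G \<Longrightarrow> B v \<in> carrier_mat t (k + 1)"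
    and ker: "\<And>v. v \<in> fst ?G \<Longrightarrow> trivial_kernel (B v)"
    and W: "\<And>v. v \<in> fst ?G \<Longrightarrow> W v = (\<lambda>c. B v *\<^sub>v c) ` carrier_vec (k + 1)"
    by metis
  have img: "B v *\<^sub>v c \<in> W v \<and> B v *\<^sub>v c \<noteq> 0\<^sub>v t \<and> B v *\<^sub>v c \<in> carrier_vec t"
    if "v \<in> fst ?G" "c \<in> carrier_vec (k + 1)" "c \<noteq> 0\<^sub>v (k + 1)" for v c
    using mult_mat_vec_nonzero[OF ker[OF that(1)], of c] B[OF that(1)] W[OF that(1)] that
    by auto
  have left: "Inl i \<in> fst ?G" if "i < k" for i
    using that unfolding complete_bipartite_def by simp
  have right: "Inr j \<in> fst ?G" if "j < m" for j
    using that unfolding complete_bipartite_def by simp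
  define x where "x i = B (Inl i) *\<^sub>v unit_vec (k + 1) 0" for i
  have x: "x i \<in> W (Inl i) \<and> x i \<noteq> 0\<^sub>v t \<and> x i \<in> carrier_vec t" if "i < k" for i
    unfolding x_def using that by (intro img left) auto
  have "\<exists>y. y \<in> W (Inr j) \<and> y \<noteq> 0\<^sub>v t \<and> y \<in> carrier_vec t \<and> (\<forall>i<k. inner y (x i) = 0)"
    if "j < m" for j
  proof -
    note BR = B[OF right[OF that]]
    \<comment> \<open>The kernel of \<open>X\<close> consists of the vectors that are orthogonal to all left choices.\<close>
    define X where "X = mat k t (\<lambda>(i, r). \<sigma> (x i $ r))"
    have X: "X \<in> carrier_mat k t" unfolding X_def by simp
    obtain c where c: "c \<in> carrier_vec (k + 1)" "c \<noteq> 0\<^sub>v (k + 1)"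
      and zero: "(X * B (Inr j)) *\<^sub>v c = 0\<^sub>v k"
      using homogeneous_system_nonzero_solution[of "X * B (Inr j)" k] X BR by auto
    define y where "y = B (Inr j) *\<^sub>v c"
    have y: "y \<in> W (Inr j) \<and> y \<noteq> 0\<^sub>v t \<and> y \<in> carrier_vec t"
      unfolding y_def using img[OF right[OF that] c] .
    have "inner y (x i) = 0" if "i < k" for i
    proof -
      have "row X i = map_vec \<sigma> (x i)"
        using that x[OF that] unfolding X_def by (intro eq_vecI) auto
      then have "inner y (x i) = y \<bullet> row X i" by (simp add: inner_def)
      also have "\<dots> = row X i \<bullet> y"
        using y X that by (intro comm_scalar_prod[of _ t]) auto
      also have "\<dots> = (X *\<^sub>v y) $ i" using X that by simp
      also have "X *\<^sub>v y = 0\<^sub>v k"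
        using zero assoc_mult_mat_vec[OF X BR c(1)] by (simp add: y_def)
      finally show ?thesis using that by simp
    qed
    then show ?thesis using y by blast
  qed
  then obtain y where y: "\<And>j. j < m \<Longrightarrow> y j \<in> W (Inr j) \<and> y j \<noteq> 0\<^sub>v t \<and> y j \<in> carrier_vec t"
    and orth: "\<And>i j. i < k \<Longrightarrow> j < m \<Longrightarrow> inner (y j) (x i) = 0"
    by metis
  have orth': "inner (x i) (y j) = 0" if "i < k" "j < m" for i j
    using orth[OF that] inner_eq_0_commute x[OF that(1)] y[OF that(2)] by blast
  show "\<exists>z. (\<forall>v \<in> fst ?G. z v \<in> W v \<and> z v \<noteq> 0\<^sub>v t) \<and>
      (\<forall>u \<in> fst ?G. \<forall>v \<in> fst ?G. {u, v} \<in> snd ?G \<longrightarrow> inner (z u) (z v) = 0)"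
    using x y orth orth'
    by (intro exI[of _ "case_sum x y"])
      (auto simp: complete_bipartite_def doubleton_eq_iff)
qed

end

section \<open>Subspaces of dimension k can be too small\<close>

text \<open>
  The condition on hyperplanes through the origin counts indices rather than vectors, so that
  repetitions in the family are allowed but counted. They occur on the moment curve for
  \<open>k = 1\<close>, where all its points coincide.
\<close>

definition spread_out :: "nat \<Rightarrow> nat \<Rightarrow> nat \<Rightarrow> (nat \<Rightarrow> 'a::field vec) \<Rightarrow> bool" where
  "spread_out k d m a \<longleftrightarrow>
     (\<forall>j < m. a j \<in> carrier_vec k \<and> a j \<noteq> 0\<^sub>v k) \<and>
     (\<forall>x \<in> carrier_vec k. x \<noteq> 0\<^sub>v k \<longrightarrow> card {j. j < m \<and> x \<bullet> a j = 0} \<le> d)"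

context conjugation
begin

text \<open>
  Coordinate \<open>l\<close> of block \<open>i\<close> of a vector in \<open>F\<^sup>k\<^sup>*\<^sup>k\<close> has index \<open>i * k + l\<close>. The
  image of \<open>block_mat k i\<close> is the \<open>i\<close>-th block.
\<close>

definition block_mat :: "nat \<Rightarrow> nat \<Rightarrow> 'a mat" where
  "block_mat k i = mat (k * k) k (\<lambda>(r, c). if r = i * k + c then 1 else 0)"

text \<open>
  The image of \<open>copies_mat k a\<close> consists of the vectors whose \<open>i\<close>-th block is
  \<open>y\<^sub>i \<sigma>(a)\<close>. The product with such a vector applies \<open>\<sigma>\<close> once more, so the vector \<open>a\<close>
  itself appears in the inner products.
\<close>

definition copies_mat :: "nat \<Rightarrow> 'a vec \<Rightarrow> 'a mat" where
  "copies_mat k a = mat (k * k) k (\<lambda>(r, c). if r div k = c then \<sigma> (a $ (r mod k)) else 0)"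

lemma block_mat_carrier: "block_mat k i \<in> carrier_mat (k * k) k"
  by (simp add: block_mat_def)

lemma copies_mat_carrier: "copies_mat k a \<in> carrier_mat (k * k) k"
  by (simp add: copies_mat_def)

lemma block_index_less: "i < k \<Longrightarrow> l < k \<Longrightarrow> i * k + l < k * (k :: nat)"
  using mult_le_mono1[of "i + 1" k k] by simp

lemma index_block_mat_mult:
  assumes "x \<in> carrier_vec k" "r < k * k"
  shows "(block_mat k i *\<^sub>v x) $ r = (\<Sum>l<k. if r = i * k + l then x $ l else 0)"
  using assms unfolding block_mat_def
  by (auto simp: scalar_prod_def atLeast0LessThan intro!: sum.cong)

lemma index_copies_mat_mult:
  assumes "y \<in> carrier_vec k" "i < k" "l < k"
  shows "(copies_mat k a *\<^sub>v y) $ (i * k + l) = y $ i * \<sigma> (a $ l)"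
  using assms block_index_less[OF assms(2,3)] unfolding copies_mat_def
  by (auto simp: scalar_prod_def atLeast0LessThan if_distrib[of "\<lambda>x. _ * x"] if_distrib[of "\<lambda>x. x * _"] mult.commute cong: if_cong)

lemma inner_block_copies:
  assumes x: "x \<in> carrier_vec k" and y: "y \<in> carrier_vec k" and a: "a \<in> carrier_vec k"
    and i: "i < k"
  shows "inner (block_mat k i *\<^sub>v x) (copies_mat k a *\<^sub>v y) = \<sigma> (y $ i) * (x \<bullet> a)"
proof -
  let ?w = "copies_mat k a *\<^sub>v y"
  have dim: "dim_vec ?w = k * k" by (simp add: copies_mat_def)
  have "inner (block_mat k i *\<^sub>v x) ?w =
      (\<Sum>r<k*k. (block_mat k i *\<^sub>v x) $ r * \<sigma> (?w $ r))"
    unfolding inner_def scalar_prod_def using dim by (auto simp: atLeast0LessThan intro!: sum.cong)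
  also have "\<dots> = (\<Sum>r<k*k. (\<Sum>l<k. if r = i * k + l then x $ l * \<sigma> (?w $ (i * k + l)) else 0))"
    by (intro sum.cong refl)
      (auto simp: index_block_mat_mult[OF x] sum_distrib_right intro!: sum.cong)
  also have "\<dots> = (\<Sum>l<k. \<Sum>r<k*k. if r = i * k + l then x $ l * \<sigma> (?w $ (i * k + l)) else 0)"
    by (rule sum.swap)
  also have "\<dots> = (\<Sum>l<k. x $ l * \<sigma> (?w $ (i * k + l)))"
    using block_index_less[OF i] by (intro sum.cong refl) auto
  also have "\<dots> = (\<Sum>l<k. \<sigma> (y $ i) * (x $ l * a $ l))"
    by (intro sum.cong refl) (simp add: index_copies_mat_mult[OF y i] conj_mult conj_conj)
  also have "\<dots> = \<sigma> (y $ i) * (x \<bullet> a)"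
    using a unfolding scalar_prod_def by (simp add: sum_distrib_left atLeast0LessThan)
  finally show ?thesis .
qed

lemma trivial_kernel_block_mat:
  assumes "i < k"
  shows "trivial_kernel (block_mat k i)"
  unfolding trivial_kernel_def
proof (intro ballI impI)
  fix c assume "c \<in> carrier_vec (dim_col (block_mat k i))"
    and zero: "block_mat k i *\<^sub>v c = 0\<^sub>v (dim_row (block_mat k i))"
  then have c: "c \<in> carrier_vec k" by (simp add: block_mat_def)
  have "c $ l = 0" if "l < k" for l
  proof -
    have "(block_mat k i *\<^sub>v c) $ (i * k + l) = 0"
      using zero block_index_less[OF assms that] by (simp add: block_mat_def)
    then show ?thesis
      using index_block_mat_mult[OF c block_index_less[OF assms that], of i] that by simp
  qed
  then show "c = 0\<^sub>v (dim_col (block_mat k i))"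
    using c by (intro eq_vecI) (auto simp: block_mat_def)
qed

lemma trivial_kernel_copies_mat:
  assumes "a \<in> carrier_vec k" "a \<noteq> 0\<^sub>v k"
  shows "trivial_kernel (copies_mat k a)"
  unfolding trivial_kernel_def
proof (intro ballI impI)
  fix c assume "c \<in> carrier_vec (dim_col (copies_mat k a))"
    and zero: "copies_mat k a *\<^sub>v c = 0\<^sub>v (dim_row (copies_mat k a))"
  then have c: "c \<in> carrier_vec k" by (simp add: copies_mat_def)
  obtain l where l: "l < k" "a $ l \<noteq> 0"
    using nonzero_vec_coordinate[OF assms] by blast
  have "c $ i = 0" if "i < k" for i
  proof -
    have "(copies_mat k a *\<^sub>v c) $ (i * k + l) = 0"
      using zero block_index_less[OF that l(1)] by (simp add: copies_mat_def)
    then show ?thesis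
      using index_copies_mat_mult[OF c that l(1), of a] l(2) by (simp add: conj_eq_0_iff)
  qed
  then show "c = 0\<^sub>v (dim_col (copies_mat k a))"
    using c by (intro eq_vecI) (auto simp: copies_mat_def)
qed

text \<open>
  Each left choice is orthogonal to \<open>a\<^sub>j\<close> for at most \<open>d\<close> indices \<open>j\<close>, so that together
  they exclude at most \<open>k * d < m\<close> of them; at a right vertex that is not excluded, the equations \<open>\<sigma>(y\<^sub>i) (x\<^sub>i \<bullet> a\<^sub>j) = 0\<close> leave only \<open>y = 0\<close>.
\<close>

lemma not_choosable_if_spread_out:
  fixes a :: "nat \<Rightarrow> 'a vec"
  assumes a: "spread_out k d m a" and m: "k * d < m"
  shows "\<not> subspace_choosable inner (complete_bipartite k m) k"
proof
  let ?G = "complete_bipartite k m"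
  assume ch: "subspace_choosable inner ?G k"
  have aj: "a j \<in> carrier_vec k" "a j \<noteq> 0\<^sub>v k" if "j < m" for j
    using a that unfolding spread_out_def by auto
  define B where "B = case_sum (block_mat k) (\<lambda>j. copies_mat k (a j))"
  have B: "B v \<in> carrier_mat (k * k) k" "trivial_kernel (B v)" if "v \<in> fst ?G" for v
    using that trivial_kernel_block_mat trivial_kernel_copies_mat[OF aj]
    by (auto simp: B_def complete_bipartite_def block_mat_carrier copies_mat_carrier)
  define W where "W v = (\<lambda>c. B v *\<^sub>v c) ` carrier_vec k" for v
  have "\<forall>v \<in> fst ?G. subspace_of_dim (k * k) k (W v)"
    unfolding subspace_of_dim_iff_image W_def using B by blast
  then obtain z where z: "\<And>v. v \<in> fst ?G \<Longrightarrow> z v \<in> W v \<and> z v \<noteq> 0\<^sub>v (k * k)"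
    and orth: "\<And>u v. u \<in> fst ?G \<Longrightarrow> v \<in> fst ?G \<Longrightarrow> {u, v} \<in> snd ?G \<Longrightarrow> inner (z u) (z v) = 0"
    using ch[unfolded subspace_choosable_def, rule_format, of "k * k" W] by blast
  have "\<exists>c. c \<in> carrier_vec k \<and> c \<noteq> 0\<^sub>v k \<and> z v = B v *\<^sub>v c" if v: "v \<in> fst ?G" for v
  proof -
    obtain c where c: "c \<in> carrier_vec k" "z v = B v *\<^sub>v c"
      using z[OF v] unfolding W_def by auto
    have "B v *\<^sub>v 0\<^sub>v k = 0\<^sub>v (k * k)" using B(1)[OF v] by auto
    then show ?thesis using c z[OF v] by metis
  qed
  then obtain c where c: "\<And>v. v \<in> fst ?G \<Longrightarrow> c v \<in> carrier_vec k \<and> c v \<noteq> 0\<^sub>v k \<and> z v = B v *\<^sub>v c v"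
    by metis
  have left: "Inl i \<in> fst ?G" if "i < k" for i
    using that unfolding complete_bipartite_def by simp
  have right: "Inr j \<in> fst ?G" if "j < m" for j
    using that unfolding complete_bipartite_def by simp
  define Z where "Z i = {j. j < m \<and> c (Inl i) \<bullet> a j = 0}" for i
  have "card (\<Union>i<k. Z i) \<le> (\<Sum>i<k. card (Z i))" by (rule card_UN_le) simp
  also have "\<dots> \<le> (\<Sum>i<k. d)"
    using a c[OF left] unfolding Z_def spread_out_def by (intro sum_mono) auto
  also have "\<dots> < card {..<m}" using m by simp
  finally have "\<not> {..<m} \<subseteq> (\<Union>i<k. Z i)"
    using card_mono[of "\<Union>i<k. Z i" "{..<m}"] by (auto simp: Z_def)
  then obtain j where j: "j < m" and good: "\<And>i. i < k \<Longrightarrow> c (Inl i) \<bullet> a j \<noteq> 0"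
    unfolding Z_def by auto
  have "c (Inr j) $ i = 0" if i: "i < k" for i
  proof -
    have "{Inl i, Inr j} \<in> snd ?G" using i j by (auto simp: complete_bipartite_def)
    then have "inner (z (Inl i)) (z (Inr j)) = 0" using orth left[OF i] right[OF j] by blast
    then have "\<sigma> (c (Inr j) $ i) * (c (Inl i) \<bullet> a j) = 0"
      using inner_block_copies[OF _ _ aj(1)[OF j] i] c[OF left[OF i]] c[OF right[OF j]]
      by (simp add: B_def)
    then show ?thesis using good[OF i] by (simp add: conj_eq_0_iff)
  qed
  then have "c (Inr j) = 0\<^sub>v k" using c[OF right[OF j]] by (intro eq_vecI) auto
  then show False using c[OF right[OF j]] by blast
qed

lemma threshold_le_if_spread_out:
  fixes a :: "nat \<Rightarrow> 'a vec"
  assumes a: "spread_out k d (k * d + 1) a"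
  shows "bipartite_threshold inner k \<le> enat (k * d + 1)"
proof -
  let ?G = "complete_bipartite k (k * d + 1)"
  \<comment> \<open>Monotonicity excludes all smaller dimensions together with \<open>k\<close>.\<close>
  have "\<not> subspace_choosable inner ?G j" if "j \<le> k" for j
    using not_choosable_if_spread_out[OF a] subspace_choosable_mono[OF _ that, of inner ?G] by auto
  then have "k + 1 \<le> j" if "subspace_choosable inner ?G j" for j
    using that by (metis Suc_eq_plus1 not_less_eq_eq)
  then have "subspace_choice_number inner ?G = enat (k + 1)"
    unfolding subspace_choice_number_def
    using choosable_complete_bipartite_Suc[of k "k * d + 1"]
    by (intro antisym Inf_lower Inf_greatest) auto
  then show ?thesis unfolding bipartite_threshold_def by (intro Inf_lower) auto
qed

end

section \<open>Vectors on the moment curve\<close>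

lemma ex_spread_out_vandermonde:
  assumes k: "k \<ge> 1"
    and large: "infinite (UNIV :: 'a::field set) \<or> card (UNIV :: 'a set) \<ge> m"
  shows "\<exists>a :: nat \<Rightarrow> 'a vec. spread_out k (k - 1) m a"
proof -
  obtain S :: "'a set" where S: "finite S" "card S = m"
    using large infinite_arbitrarily_large[of "UNIV :: 'a set" m]
      obtain_subset_with_card_n[of m "UNIV :: 'a set"] by metis
  then obtain t where t: "bij_betw t {0..<m} S"
    using ex_bij_betw_nat_finite by blast
  define a where "a j = vec k (\<lambda>c. t j ^ c)" for j
  have "a j $ 0 \<noteq> 0\<^sub>v k $ 0" for j unfolding a_def using k by simp
  then have nonzero: "a j \<noteq> 0\<^sub>v k" for j by metis
  have "card {j. j < m \<and> x \<bullet> a j = 0} \<le> k - 1"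
    if x: "x \<in> carrier_vec k" "x \<noteq> 0\<^sub>v k" for x
  proof -
    \<comment> \<open>The product of \<open>x\<close> with the curve point of parameter \<open>t\<close> is the value of \<open>p\<close> at \<open>t\<close>.\<close>
    define p where "p = (\<Sum>c<k. monom (x $ c) c)"
    have coeff: "coeff p c = x $ c" if "c < k" for c
      using that unfolding p_def by (simp add: coeff_sum)
    have "p \<noteq> 0" using x coeff by (metis carrier_vecD coeff_0 eq_vecI index_zero_vec)
    have "degree p \<le> k - 1"
      unfolding p_def by (intro degree_sum_le) (auto intro: order_trans[OF degree_monom_le])
    have root: "poly p (t j) = x \<bullet> a j" for j
      unfolding p_def a_def scalar_prod_def
      by (simp add: poly_sum poly_monom atLeast0LessThan)
    have "card {j. j < m \<and> x \<bullet> a j = 0} \<le> card {s. poly p s = 0}"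
      using t by (intro card_inj_on_le[of t])
        (auto simp: root poly_roots_finite \<open>p \<noteq> 0\<close> bij_betw_def inj_on_def)
    also have "\<dots> \<le> degree p" using card_poly_roots_bound[OF \<open>p \<noteq> 0\<close>] .
    finally show ?thesis using \<open>degree p \<le> k - 1\<close> by simp
  qed
  then have "spread_out k (k - 1) m a"
    unfolding spread_out_def using nonzero by (auto simp: a_def)
  then show ?thesis by blast
qed


section \<open>One vector for each point of a finite projective space\<close>

lemma smult_vec_nonzero:
  fixes v :: "'a::field vec"
  assumes "v \<in> carrier_vec k" "v \<noteq> 0\<^sub>v k" "c \<noteq> 0"
  shows "c \<cdot>\<^sub>v v \<noteq> 0\<^sub>v k"
proof -
  obtain i where "i < k" "v $ i \<noteq> 0" using nonzero_vec_coordinate[OF assms(1,2)] .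
  then have "(c \<cdot>\<^sub>v v) $ i \<noteq> 0\<^sub>v k $ i" using assms by simp
  then show ?thesis by metis
qed

text \<open>
  The first nonzero entry singles out one representative on each line through the origin, the one
  where it equals \<open>1\<close>. It is unspecified at the zero vector.
\<close>

definition lead :: "'a::field vec \<Rightarrow> 'a" where
  "lead v = v $ (LEAST i. i < dim_vec v \<and> v $ i \<noteq> 0)"

lemma lead_nonzero:
  assumes "v \<in> carrier_vec k" "v \<noteq> 0\<^sub>v k"
  shows "lead v \<noteq> 0"
proof -
  have "\<exists>i. i < dim_vec v \<and> v $ i \<noteq> 0"
    using nonzero_vec_coordinate[OF assms(1,2)] assms(1) by auto
  then show ?thesis unfolding lead_def by (metis (mono_tags, lifting) LeastI_ex)
qed

lemma lead_smult:
  assumes "v \<in> carrier_vec k" "v \<noteq> 0\<^sub>v k" "c \<noteq> 0"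
  shows "lead (c \<cdot>\<^sub>v v) = c * lead v"
proof -
  let ?P = "\<lambda>i. i < dim_vec v \<and> v $ i \<noteq> 0"
  have "\<exists>i. ?P i"
    using nonzero_vec_coordinate[OF assms(1,2)] assms(1) by auto
  then have "?P (LEAST i. ?P i)" by (rule LeastI_ex)
  moreover have "(\<lambda>i. i < dim_vec (c \<cdot>\<^sub>v v) \<and> (c \<cdot>\<^sub>v v) $ i \<noteq> 0) = ?P"
    using assms(3) by auto
  ultimately show ?thesis unfolding lead_def by simp
qed

definition normalized :: "nat \<Rightarrow> 'a::field vec set" where
  "normalized k = {v \<in> carrier_vec k. v \<noteq> 0\<^sub>v k \<and> lead v = 1}"

lemma card_carrier_vec:
  assumes "finite (UNIV :: 'a set)"
  shows "finite (carrier_vec k :: 'a vec set)"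
    and "card (carrier_vec k :: 'a vec set) = card (UNIV :: 'a set) ^ k"
proof -
  let ?L = "{xs :: 'a list. set xs \<subseteq> UNIV \<and> length xs = k}"
  have bij: "bij_betw vec_of_list ?L (carrier_vec k)"
    by (rule bij_betw_byWitness[where f' = list_of_vec])
      (auto simp: list_vec vec_list intro!: carrier_vecI)
  show "finite (carrier_vec k :: 'a vec set)"
    using bij_betw_finite[OF bij] finite_lists_length_eq[OF assms] by simp
  show "card (carrier_vec k :: 'a vec set) = card (UNIV :: 'a set) ^ k"
    using bij_betw_same_card[OF bij] card_lists_length_eq[OF assms] by simp
qed

text \<open>
  Every nonzero vector of \<open>S\<close> is \<open>c \<cdot>\<^sub>v v\<close> for exactly one \<open>c \<noteq> 0\<close> and one normalized
  \<open>v\<close>. The count is used for the whole space and for hyperplanes.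
\<close>

lemma card_normalized_Int:
  fixes S :: "'a::field vec set"
  assumes fin: "finite (UNIV :: 'a set)"
    and S: "S \<subseteq> carrier_vec k" "0\<^sub>v k \<in> S"
    and scale: "\<And>c v. v \<in> S \<Longrightarrow> c \<cdot>\<^sub>v v \<in> S"
  shows "card (S \<inter> normalized k) * (card (UNIV :: 'a set) - 1) = card S - 1"
proof -
  let ?f = "\<lambda>(v :: 'a vec, c :: 'a). c \<cdot>\<^sub>v v"
  have inv: "inverse (lead v) \<cdot>\<^sub>v v \<in> S \<inter> normalized k" if v: "v \<in> S - {0\<^sub>v k}" for v
  proof -
    have v': "v \<in> carrier_vec k" "v \<noteq> 0\<^sub>v k" using v S by auto
    have "lead (inverse (lead v) \<cdot>\<^sub>v v) = 1"
      using lead_smult[OF v'] lead_nonzero[OF v'] by simp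
    moreover have "inverse (lead v) \<cdot>\<^sub>v v \<noteq> 0\<^sub>v k"
      using smult_vec_nonzero[OF v'] lead_nonzero[OF v'] by simp
    ultimately show ?thesis using v v' scale unfolding normalized_def by auto
  qed
  have "bij_betw ?f ((S \<inter> normalized k) \<times> (UNIV - {0})) (S - {0\<^sub>v k})"
  proof (rule bij_betw_byWitness[where f' = "\<lambda>v. (inverse (lead v) \<cdot>\<^sub>v v, lead v)"])
    show "\<forall>p \<in> (S \<inter> normalized k) \<times> (UNIV - {0}).
        (\<lambda>v. (inverse (lead v) \<cdot>\<^sub>v v, lead v)) (?f p) = p"
      by (auto simp: normalized_def lead_smult smult_smult_assoc)
    show "\<forall>v \<in> S - {0\<^sub>v k}. ?f (inverse (lead v) \<cdot>\<^sub>v v, lead v) = v"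
      using lead_nonzero[OF subsetD[OF S(1)]] by (auto simp: smult_smult_assoc)
    show "?f ` ((S \<inter> normalized k) \<times> (UNIV - {0})) \<subseteq> S - {0\<^sub>v k}"
    proof safe
      fix v :: "'a vec" and c :: 'a
      assume v: "v \<in> S" "v \<in> normalized k" and c: "c \<noteq> 0"
      show "c \<cdot>\<^sub>v v \<in> S" using scale v by blast
      assume "c \<cdot>\<^sub>v v = 0\<^sub>v k"
      then show False using smult_vec_nonzero[of v k c] v c by (simp add: normalized_def)
    qed
    show "(\<lambda>v. (inverse (lead v) \<cdot>\<^sub>v v, lead v)) ` (S - {0\<^sub>v k})
        \<subseteq> (S \<inter> normalized k) \<times> (UNIV - {0})"
      using inv lead_nonzero S by blast
  qed
  from bij_betw_same_card[OF this] show ?thesis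
    using S(2) fin finite_subset[OF S(1) card_carrier_vec(1)[OF fin]]
    by (simp add: card_cartesian_product card_Diff_singleton)
qed

text \<open>
  If \<open>x\<close> is nonzero at position \<open>i\<close>, the translates of the hyperplane in direction \<open>i\<close> are
  pairwise disjoint, because \<open>x \<bullet> v\<close> tells them apart.
\<close>

lemma card_hyperplane_le:
  fixes x :: "'a::field vec"
  assumes fin: "finite (UNIV :: 'a set)" and x: "x \<in> carrier_vec k" "x \<noteq> 0\<^sub>v k"
  shows "card {v \<in> carrier_vec k. x \<bullet> v = 0} \<le> card (UNIV :: 'a set) ^ (k - 1)"
proof -
  let ?H = "{v \<in> carrier_vec k. x \<bullet> v = 0}" and ?q = "card (UNIV :: 'a set)"
  obtain i where i: "i < k" "x $ i \<noteq> 0"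
    using nonzero_vec_coordinate[OF x] by blast
  let ?f = "\<lambda>(v, s). v + s \<cdot>\<^sub>v unit_vec k i"
  have val: "x \<bullet> (v + s \<cdot>\<^sub>v unit_vec k i) = s * x $ i" if "v \<in> ?H" for v s
    using that x i by (simp add: scalar_prod_add_distrib[of _ k])
  have "inj_on ?f (?H \<times> UNIV)"
  proof (rule inj_onI, clarify)
    fix v s w r
    assume v: "v \<in> carrier_vec k" "x \<bullet> v = 0" and w: "w \<in> carrier_vec k" "x \<bullet> w = 0"
      and eq: "v + s \<cdot>\<^sub>v unit_vec k i = w + r \<cdot>\<^sub>v unit_vec k i"
    have "s * x $ i = r * x $ i" using val[of v s] val[of w r] v w eq by (metis (mono_tags, lifting) mem_Collect_eq)
    then have "s = r" using i(2) by (metis mult_right_cancel)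
    moreover have "v = w" using eq v w unfolding \<open>s = r\<close>
      by (intro eq_vecI) (auto simp: vec_eq_iff)
    ultimately show "v = w \<and> s = r" by blast
  qed
  moreover have "?f ` (?H \<times> UNIV) \<subseteq> carrier_vec k" by auto
  ultimately have "card (?H \<times> (UNIV :: 'a set)) \<le> card (carrier_vec k :: 'a vec set)"
    using card_inj_on_le card_carrier_vec(1)[OF fin] by blast
  then have "card ?H * ?q \<le> ?q ^ (k - 1) * ?q"
    using i by (cases k) (auto simp: card_cartesian_product card_carrier_vec(2)[OF fin] mult.commute)
  moreover have "?q > 0" using fin by (simp add: finite_UNIV_card_ge_0)
  ultimately show ?thesis by simp
qed

lemma ex_spread_out_projective:
  assumes fin: "finite (UNIV :: 'a::field set)" and q: "card (UNIV :: 'a set) = q"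
    and k: "k \<ge> 1" "k \<le> q"
  defines "d \<equiv> (q ^ (k - 1) - 1) div (q - 1)"
  shows "\<exists>a :: nat \<Rightarrow> 'a vec. spread_out k d (k * d + 1) a"
proof -
  have "card {0, 1 :: 'a} \<le> q" unfolding q[symmetric] using fin by (intro card_mono) auto
  then have q2: "q \<ge> 2" by simp
  have finP: "finite (normalized k :: 'a vec set)"
    using card_carrier_vec(1)[OF fin] by (simp add: normalized_def)
  have "card (normalized k :: 'a vec set) * (q - 1) = q ^ k - 1"
    using card_normalized_Int[OF fin, of "carrier_vec k" k] card_carrier_vec(2)[OF fin, of k] q
    by (simp add: normalized_def Int_absorb1 Collect_conj_eq)
  \<comment> \<open>The hypothesis \<open>k \<le> q\<close> enters here: the space has enough points.\<close>
  moreover have "(k * d + 1) * (q - 1) \<le> q ^ k - 1"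
  proof -
    have "d * (q - 1) \<le> q ^ (k - 1) - 1" unfolding d_def by simp
    then have "k * (d * (q - 1)) \<le> q * (q ^ (k - 1) - 1)" using k(2) by (rule mult_le_mono[rotated])
    also have "\<dots> = q ^ k - q"
      using k(1) by (cases k) (auto simp: diff_mult_distrib2)
    finally have "(k * d + 1) * (q - 1) \<le> (q ^ k - q) + (q - 1)"
      by (simp add: algebra_simps)
    moreover have "q \<le> q ^ k" using k(1) q2 self_le_power[of q k] by simp
    ultimately show ?thesis using q2 by simp
  qed
  ultimately have many: "k * d + 1 \<le> card (normalized k :: 'a vec set)"
    using q2 by (metis mult_le_cancel2 zero_less_diff less_le_trans one_less_numeral_iff semiring_norm(76))
  obtain a :: "nat \<Rightarrow> 'a vec" where a: "bij_betw a {0..<card (normalized k :: 'a vec set)} (normalized k)"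
    using ex_bij_betw_nat_finite[OF finP] by blast
  have aP: "a j \<in> normalized k" if "j < k * d + 1" for j
    using a that many by (auto simp: bij_betw_def)
  have inj: "inj_on a {..<k * d + 1}"
    using a many by (auto simp: bij_betw_def intro: inj_on_subset)
  have "card {j. j < k * d + 1 \<and> x \<bullet> a j = 0} \<le> d"
    if x: "x \<in> carrier_vec k" "x \<noteq> 0\<^sub>v k" for x
  proof -
    let ?H = "{v \<in> carrier_vec k. x \<bullet> v = 0}"
    have "card (?H \<inter> normalized k) * (q - 1) = card ?H - 1"
      using card_normalized_Int[OF fin, of ?H k] x q by auto
    also have "\<dots> \<le> q ^ (k - 1) - 1"
      using card_hyperplane_le[OF fin x] q by simp
    finally have "card (?H \<inter> normalized k) \<le> d"
      unfolding d_def using q2 by (simp add: less_eq_div_iff_mult_less_eq)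
    moreover have "card {j. j < k * d + 1 \<and> x \<bullet> a j = 0} \<le> card (?H \<inter> normalized k)"
      using aP finP
      by (intro card_inj_on_le[of a]) (auto intro: inj_on_subset[OF inj] simp: normalized_def)
    ultimately show ?thesis by simp
  qed
  then have "spread_out k d (k * d + 1) a"
    unfolding spread_out_def using aP by (auto simp: normalized_def)
  then show ?thesis by blast
qed

section \<open>The bounds on the threshold\<close>

interpretation bilinear: conjugation "\<lambda>x :: 'a::field. x"
  rewrites "conjugation.inner (\<lambda>x :: 'a. x) = scalar_prod"
proof -
  show conj: "conjugation (\<lambda>x :: 'a. x)" by unfold_locales auto
  show "conjugation.inner (\<lambda>x :: 'a. x) = scalar_prod"
    by (intro ext) (simp add: conjugation.inner_def[OF conj] scalar_prod_def)
qed

interpretation hermitian: conjugation cnj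
  rewrites "conjugation.inner cnj = cscalar_prod"
proof -
  show conj: "conjugation cnj" by unfold_locales auto
  show "conjugation.inner cnj = cscalar_prod"
    by (intro ext) (simp add: conjugation.inner_def[OF conj] scalar_prod_def)
qed

theorem corollary1p6:
  fixes k :: nat
  assumes "k \<ge> 1"
  shows
    "(infinite (UNIV :: 'a::field set) \<or> card (UNIV :: 'a set) \<ge> k^2 - k + 1 \<longrightarrow>
        bipartite_threshold (scalar_prod :: 'a vec \<Rightarrow> 'a vec \<Rightarrow> 'a) k \<le> enat (k^2 - k + 1)) \<and>
     bipartite_threshold (cscalar_prod :: complex vec \<Rightarrow> complex vec \<Rightarrow> complex) k
        \<le> enat (k^2 - k + 1) \<and>
     (\<forall>q. finite (UNIV :: 'a set) \<and> card (UNIV :: 'a set) = q \<and> q \<ge> k \<longrightarrow>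
        bipartite_threshold (scalar_prod :: 'a vec \<Rightarrow> 'a vec \<Rightarrow> 'a) k
          \<le> enat (k * ((q^(k - 1) - 1) div (q - 1)) + 1))"
proof -
  have m: "k * (k - 1) + 1 = k^2 - k + 1"
    by (simp add: diff_mult_distrib2 power2_eq_square)
  have "bipartite_threshold (scalar_prod :: 'a vec \<Rightarrow> 'a vec \<Rightarrow> 'a) k \<le> enat (k^2 - k + 1)"
    if large: "infinite (UNIV :: 'a set) \<or> card (UNIV :: 'a set) \<ge> k^2 - k + 1"
  proof -
    obtain a :: "nat \<Rightarrow> 'a vec" where "spread_out k (k - 1) (k^2 - k + 1) a"
      using ex_spread_out_vandermonde[OF assms large] by blast
    from bilinear.threshold_le_if_spread_out[OF this[folded m]] show ?thesis unfolding m .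
  qed
  moreover have "bipartite_threshold (cscalar_prod :: complex vec \<Rightarrow> complex vec \<Rightarrow> complex) k \<le> enat (k^2 - k + 1)"
  proof -
    obtain a :: "nat \<Rightarrow> complex vec" where "spread_out k (k - 1) (k^2 - k + 1) a"
      using ex_spread_out_vandermonde[OF assms] infinite_UNIV_char_0 by metis
    from hermitian.threshold_le_if_spread_out[OF this[folded m]] show ?thesis unfolding m .
  qed
  moreover have "bipartite_threshold (scalar_prod :: 'a vec \<Rightarrow> 'a vec \<Rightarrow> 'a) k
      \<le> enat (k * ((q^(k - 1) - 1) div (q - 1)) + 1)"
    if "finite (UNIV :: 'a set)" "card (UNIV :: 'a set) = q" "q \<ge> k" for q
    using ex_spread_out_projective[OF that(1,2) assms that(3)]
      bilinear.threshold_le_if_spread_out by blast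
  ultimately show ?thesis by blast
qed

end
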